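(* Let $G$ be a graph, $S$ a symmetry group in dimension $d$, $\Phi:S\to\mathrm{Aut}(G)$ a map, and $(G,p)\in\mathscr{R}_{(G,S,\Phi)}$. Then the following two conditions are equivalent: (a) for every map $\Psi:S\to\mathrm{Aut}(G)$ distinct from $\Phi$, $(G,p)\notin\mathscr{R}_{(G,S,\Psi)}$; (b) $\mathrm{Aut}(G,p)=\{id\}$.
   Context: Graphs are finite, simple, with nonempty vertex set. $\mathrm{Aut}(G)$ is the group (under composition) of automorphisms of $G$; $id$ is its identity. A framework in $\mathbb{R}^d$ (also called a $d$-dimensional realization of $G$) is a pair $(G,p)$ with $G$ a graph and $p:V(G)\to\mathbb{R}^d$ a map with $p(u)\neq p(v)$ whenever $\{u,v\}\in E(G)$; $p$ need not be injective. A symmetry operation of $(G,p)$ is an isometry $x$ of $\mathbb{R}^d$ such that for some $\alpha\in\mathrm{Aut}(G)$, $x(p(v))=p(\alpha(v))$ for all $v\in V(G)$. The point group of $(G,p)$ is the group of all its symmetry operations. A symmetry group in dimension $d$ is a subgroup of the orthogonal group $O(\mathbb{R}^d)$. $\mathscr{R}_{(G,S)}$ is the set of all $d$-dimensional realizations of $G$ whose point group equals $S$ or contains $S$ as a subgroup. For a map $\Phi:S\to\mathrm{Aut}(G)$ (not necessarily a homomorphism), $\mathscr{R}_{(G,S,\Phi)}$ is the set of all $(G,p)\in\mathscr{R}_{(G,S)}$ with $x(p(v))=p(\Phi(x)(v))$ for all $v\in V(G)$ and all $x\in S$. $\mathrm{Aut}(G,p)$ denotes the set (a subgroup of $\mathrm{Aut}(G)$)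 of all $\alpha\in\mathrm{Aut}(G)$ with $p(v)=p(\alpha(v))$ for all $v\in V(G)$. *)

theory Defs
  imports
    "HOL-Analysis.Analysis"
    "HOL-Algebra.Group"
    "HOL-Combinatorics.Permutations"
    "Graph_Theory.Pair_Digraph"
begin

(* A pair_graph is finite, loop-free and has a symmetric arc set; the undirected edge {u, v}
   is represented by the two arcs (u, v) and (v, u). pair_graph allows no vertices at all. *)
definition simple_graph :: "'v pair_pre_digraph \<Rightarrow> bool" where
  "simple_graph G \<longleftrightarrow> pair_graph G \<and> pverts G \<noteq> {}"

(* Automorphisms are total functions fixing everything outside the vertex set ("permutes"),
   so that equality of automorphisms is equality of functions. *)
definition aut_group :: "'v pair_pre_digraph \<Rightarrow> ('v \<Rightarrow> 'v) monoid" where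
  "aut_group G =
     \<lparr>carrier = {\<alpha>. \<alpha> permutes pverts G \<and>
        (\<forall>u\<in>pverts G. \<forall>v\<in>pverts G. (u, v) \<in> parcs G \<longleftrightarrow> (\<alpha> u, \<alpha> v) \<in> parcs G)},
      monoid.mult = (\<circ>), one = id\<rparr>"

abbreviation Aut :: "'v pair_pre_digraph \<Rightarrow> ('v \<Rightarrow> 'v) set" where
  "Aut G \<equiv> carrier (aut_group G)"

(* The values of p outside the vertex set are never used. *)
definition framework :: "'v pair_pre_digraph \<Rightarrow> ('v \<Rightarrow> real ^ 'n) \<Rightarrow> bool" where
  "framework G p \<longleftrightarrow> simple_graph G \<and> (\<forall>(u, v)\<in>parcs G. p u \<noteq> p v)"

(* Distance preservation is enough: such a self-map of R^d is automatically bijective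
   (see isometry_bij below). *)
definition isometry :: "(real ^ 'n \<Rightarrow> real ^ 'n) \<Rightarrow> bool" where
  "isometry x \<longleftrightarrow> (\<forall>a b. dist (x a) (x b) = dist a b)"

definition symmetry_operation ::
    "'v pair_pre_digraph \<Rightarrow> ('v \<Rightarrow> real ^ 'n) \<Rightarrow> (real ^ 'n \<Rightarrow> real ^ 'n) \<Rightarrow> bool" where
  "symmetry_operation G p x \<longleftrightarrow>
     isometry x \<and> (\<exists>\<alpha>\<in>Aut G. \<forall>v\<in>pverts G. x (p v) = p (\<alpha> v))"

definition point_group ::
    "'v pair_pre_digraph \<Rightarrow> ('v \<Rightarrow> real ^ 'n) \<Rightarrow> (real ^ 'n \<Rightarrow> real ^ 'n) monoid" where
  "point_group G p =
     \<lparr>carrier = {x. symmetry_operation G p x}, monoid.mult = (\<circ>), one = id\<rparr>"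

definition orthogonal_group :: "(real ^ 'n \<Rightarrow> real ^ 'n) monoid" where
  "orthogonal_group =
     \<lparr>carrier = {x. orthogonal_transformation x}, monoid.mult = (\<circ>), one = id\<rparr>"

definition symmetry_group :: "(real ^ 'n \<Rightarrow> real ^ 'n) set \<Rightarrow> bool" where
  "symmetry_group S \<longleftrightarrow> subgroup S orthogonal_group"

(* The case that the point group equals S is included, since a group is a subgroup of itself. *)
definition realizations ::
    "'v pair_pre_digraph \<Rightarrow> (real ^ 'n \<Rightarrow> real ^ 'n) set
      \<Rightarrow> ('v pair_pre_digraph \<times> ('v \<Rightarrow> real ^ 'n)) set" where
  "realizations G S = {(G, p) | p. framework G p \<and> subgroup S (point_group G p)}"

definition realizations_of_type ::
    "'v pair_pre_digraph \<Rightarrow> (real ^ 'n \<Rightarrow> real ^ 'n) set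
      \<Rightarrow> ((real ^ 'n \<Rightarrow> real ^ 'n) \<Rightarrow> 'v \<Rightarrow> 'v)
      \<Rightarrow> ('v pair_pre_digraph \<times> ('v \<Rightarrow> real ^ 'n)) set" where
  "realizations_of_type G S \<Phi> =
     {(G, p) | p. (G, p) \<in> realizations G S \<and>
        (\<forall>v\<in>pverts G. \<forall>x\<in>S. x (p v) = p (\<Phi> x v))}"

definition Aut_framework :: "'v pair_pre_digraph \<Rightarrow> ('v \<Rightarrow> real ^ 'n) \<Rightarrow> ('v \<Rightarrow> 'v) set" where
  "Aut_framework G p = {\<alpha> \<in> Aut G. \<forall>v\<in>pverts G. p v = p (\<alpha> v)}"

lemma isometry_bij:
  fixes x :: "real ^ 'n \<Rightarrow> real ^ 'n"
  assumes "isometry x"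
  shows "bij x"
proof -
  define f where "f = (\<lambda>a. x a - x 0)"
  have "orthogonal_transformation f"
    using assms by (auto simp: orthogonal_transformation_isometry f_def isometry_def dist_norm)
  then have "bij f" by (rule orthogonal_transformation_bij)
  moreover have "x = (\<lambda>b. b + x 0) \<circ> f" by (auto simp: f_def)
  moreover have "bij (\<lambda>b. b + x 0)" by (rule bij_plus_right)
  ultimately show ?thesis using bij_comp by metis
qed

lemma isometry_inv:
  fixes x :: "real ^ 'n \<Rightarrow> real ^ 'n"
  assumes "isometry x"
  shows "isometry (inv_into UNIV x)"
  unfolding isometry_def
proof (intro allI)
  fix a b
  have *: "x (inv_into UNIV x c) = c" for c
    using isometry_bij[OF assms] by (simp add: bij_is_surj surj_f_inv_f)
  show "dist (inv_into UNIV x a) (inv_into UNIV x b) = dist a b"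
    using assms[unfolded isometry_def, rule_format, of "inv_into UNIV x a" "inv_into UNIV x b"]
    by (simp only: *)
qed

lemma Aut_inv:
  assumes "\<alpha> \<in> Aut G"
  shows "inv_into UNIV \<alpha> \<in> Aut G"
proof -
  have p: "\<alpha> permutes pverts G" using assms by (simp add: aut_group_def)
  show ?thesis
    unfolding aut_group_def
  proof (simp add: permutes_inv[OF p], intro ballI)
    fix u v assume uv: "u \<in> pverts G" "v \<in> pverts G"
    let ?u = "inv_into UNIV \<alpha> u" and ?v = "inv_into UNIV \<alpha> v"
    have "?u \<in> pverts G" "?v \<in> pverts G"
      using uv permutes_in_image[OF permutes_inv[OF p]] by auto
    then have "(?u, ?v) \<in> parcs G \<longleftrightarrow> (\<alpha> ?u, \<alpha> ?v) \<in> parcs G"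
      using assms unfolding aut_group_def by auto
    then show "((u, v) \<in> parcs G) = ((?u, ?v) \<in> parcs G)"
      by (simp only: permutes_inverses(1)[OF p])
  qed
qed

lemma group_orthogonal_group: "group (orthogonal_group :: (real ^ 'n \<Rightarrow> real ^ 'n) monoid)"
proof (rule groupI)
  fix x :: "real ^ 'n \<Rightarrow> real ^ 'n"
  assume "x \<in> carrier orthogonal_group"
  then have x: "orthogonal_transformation x" by (simp add: orthogonal_group_def)
  then show "\<exists>y\<in>carrier orthogonal_group. y \<otimes>\<^bsub>orthogonal_group\<^esub> x = \<one>\<^bsub>orthogonal_group\<^esub>"
    by (intro bexI[of _ "inv_into UNIV x"])
      (auto simp: orthogonal_group_def orthogonal_transformation_inv orthogonal_transformation_inj)
qed (simp_all add: orthogonal_group_def orthogonal_transformation_compose o_assoc, simp add: id_def)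

lemma group_aut_group: "group (aut_group G)"
proof (rule groupI)
  fix \<alpha> \<beta> assume ab: "\<alpha> \<in> Aut G" "\<beta> \<in> Aut G"
  then have "\<beta> v \<in> pverts G" if "v \<in> pverts G" for v
    using that by (simp add: aut_group_def permutes_in_image[of \<beta> "pverts G"])
  then show "\<alpha> \<otimes>\<^bsub>aut_group G\<^esub> \<beta> \<in> Aut G"
    using ab by (simp add: aut_group_def permutes_compose)
next
  fix \<alpha> assume a: "\<alpha> \<in> Aut G"
  then have "\<alpha> permutes pverts G" by (simp add: aut_group_def)
  then show "\<exists>\<beta>\<in>Aut G. \<beta> \<otimes>\<^bsub>aut_group G\<^esub> \<alpha> = \<one>\<^bsub>aut_group G\<^esub>"
    using Aut_inv[OF a] by (intro bexI[of _ "inv_into UNIV \<alpha>"]) (auto simp: aut_group_def permutes_inv_o)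
qed (simp_all add: aut_group_def o_assoc)

lemma group_point_group: "group (point_group G p)"
proof (rule groupI)
  fix x y assume "x \<in> carrier (point_group G p)" "y \<in> carrier (point_group G p)"
  then obtain \<alpha> \<beta> where xy: "isometry x" "isometry y" and ab: "\<alpha> \<in> Aut G" "\<beta> \<in> Aut G"
    and *: "\<forall>v\<in>pverts G. x (p v) = p (\<alpha> v)" "\<forall>v\<in>pverts G. y (p v) = p (\<beta> v)"
    by (auto simp: point_group_def symmetry_operation_def)
  have "\<alpha> \<circ> \<beta> \<in> Aut G"
    using monoid.m_closed[OF group.is_monoid[OF group_aut_group] ab] by (simp add: aut_group_def)
  moreover have "\<forall>v\<in>pverts G. (x \<circ> y) (p v) = p ((\<alpha> \<circ> \<beta>) v)"
  proof
    fix v assume v: "v \<in> pverts G"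
    have "\<beta> v \<in> pverts G"
      using ab(2) v by (simp add: aut_group_def permutes_in_image[of \<beta> "pverts G"])
    then show "(x \<circ> y) (p v) = p ((\<alpha> \<circ> \<beta>) v)" using * v by simp
  qed
  moreover have "isometry (x \<circ> y)" using xy by (simp add: isometry_def)
  ultimately have "symmetry_operation G p (x \<circ> y)"
    unfolding symmetry_operation_def by blast
  then show "x \<otimes>\<^bsub>point_group G p\<^esub> y \<in> carrier (point_group G p)"
    by (simp add: point_group_def)
next
  have "id \<in> Aut G" by (simp add: aut_group_def)
  then show "\<one>\<^bsub>point_group G p\<^esub> \<in> carrier (point_group G p)"
    unfolding point_group_def symmetry_operation_def by (simp add: isometry_def) (metis id_apply)
next
  fix x assume "x \<in> carrier (point_group G p)"
  then obtain \<alpha> where x: "isometry x" and a: "\<alpha> \<in> Aut G"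
    and *: "\<forall>v\<in>pverts G. x (p v) = p (\<alpha> v)"
    by (auto simp: point_group_def symmetry_operation_def)
  have pa: "\<alpha> permutes pverts G" using a by (simp add: aut_group_def)
  have "inv_into UNIV x (p v) = p (inv_into UNIV \<alpha> v)" if "v \<in> pverts G" for v
  proof -
    have "inv_into UNIV \<alpha> v \<in> pverts G" using that permutes_in_image[OF permutes_inv[OF pa]] by simp
    then have "x (p (inv_into UNIV \<alpha> v)) = p v" using * permutes_inverses(1)[OF pa] by simp
    then show ?thesis using bij_is_inj[OF isometry_bij[OF x]] by (simp add: inv_f_eq)
  qed
  then have "symmetry_operation G p (inv_into UNIV x)"
    unfolding symmetry_operation_def using isometry_inv[OF x] Aut_inv[OF a] by blast
  then have "inv_into UNIV x \<in> carrier (point_group G p)"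
    by (simp add: point_group_def)
  then show "\<exists>y\<in>carrier (point_group G p). y \<otimes>\<^bsub>point_group G p\<^esub> x = \<one>\<^bsub>point_group G p\<^esub>"
    using bij_is_inj[OF isometry_bij[OF x]]
    by (intro bexI[of _ "inv_into UNIV x"]) (auto simp: point_group_def)
qed (simp_all add: point_group_def o_assoc)

end

theory Submission
  imports Defs
begin

text \<open>
  The maps \<open>\<Psi>\<close> with \<open>(G, p)\<close> in the class of type \<open>\<Psi>\<close> are exactly those for which every
  \<open>\<Psi> x\<close> lies in the coset \<open>Aut(G, p) \<circ> \<Phi> x\<close>. So \<open>\<Phi>\<close> is the only one iff these cosets are
  singletons; since \<open>S\<close> is nonempty, this happens iff \<open>Aut(G, p)\<close> is trivial.
\<close>

lemma Aut_permutes: "\<alpha> \<in> Aut G \<Longrightarrow> \<alpha> permutes pverts G"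
  by (simp add: aut_group_def)

lemma Aut_comp: "\<alpha> \<in> Aut G \<Longrightarrow> \<beta> \<in> Aut G \<Longrightarrow> \<alpha> \<circ> \<beta> \<in> Aut G"
  using monoid.m_closed[OF group.is_monoid[OF group_aut_group], of \<alpha> G \<beta>]
  by (simp add: aut_group_def)

lemma id_in_Aut_framework: "id \<in> Aut_framework G p"
  by (simp add: Aut_framework_def aut_group_def)

text \<open>This is membership of \<beta> in the right coset of \<alpha>. As \<alpha> permutes the
  vertices, every vertex can be written as \<open>\<alpha> w\<close>, and the condition at
  \<open>\<alpha> w\<close> becomes one on \<open>p (\<beta> w)\<close> and
  \<open>p (\<alpha> w)\<close>.\<close>

lemma comp_inv_in_Aut_framework_iff:
  assumes "\<alpha> \<in> Aut G" "\<beta> \<in> Aut G"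
  shows "\<beta> \<circ> inv_into UNIV \<alpha> \<in> Aut_framework G p \<longleftrightarrow> (\<forall>v\<in>pverts G. p (\<beta> v) = p (\<alpha> v))"
proof -
  note perm = Aut_permutes[OF assms(1)]
  have "(\<forall>v\<in>pverts G. p v = p (\<beta> (inv_into UNIV \<alpha> v))) \<longleftrightarrow>
      (\<forall>v\<in>\<alpha> ` pverts G. p v = p (\<beta> (inv_into UNIV \<alpha> v)))"
    by (simp only: permutes_image[OF perm])
  also have "\<dots> \<longleftrightarrow> (\<forall>v\<in>pverts G. p (\<beta> v) = p (\<alpha> v))"
    by (auto simp: permutes_inverses(2)[OF perm])
  finally show ?thesis
    using Aut_comp[OF assms(2) Aut_inv[OF assms(1)]] by (simp add: Aut_framework_def)
qed

text \<open>The given type already fixes \<open>x (p v)\<close> as \<open>p (\<Phi> x v)\<close>, so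
  type \<Psi> only asks that \<open>\<Psi> x\<close> and \<open>\<Phi> x\<close> send each vertex to
  vertices at the same point.\<close>

lemma realizations_of_type_iff_coset:
  assumes "\<Phi> \<in> S \<rightarrow> Aut G" "\<Psi> \<in> S \<rightarrow> Aut G" "(G, p) \<in> realizations_of_type G S \<Phi>"
  shows "(G, p) \<in> realizations_of_type G S \<Psi> \<longleftrightarrow>
    (\<forall>x\<in>S. \<Psi> x \<circ> inv_into UNIV (\<Phi> x) \<in> Aut_framework G p)"
proof -
  have "(G, p) \<in> realizations_of_type G S \<Psi> \<longleftrightarrow> (\<forall>x\<in>S. \<forall>v\<in>pverts G. p (\<Psi> x v) = p (\<Phi> x v))"
    using assms(3) unfolding realizations_of_type_def by auto
  also have "\<dots> \<longleftrightarrow> (\<forall>x\<in>S. \<Psi> x \<circ> inv_into UNIV (\<Phi> x) \<in> Aut_framework G p)"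
    using assms(1,2) by (intro ball_cong refl comp_inv_in_Aut_framework_iff[symmetric]) auto
  finally show ?thesis .
qed

theorem corollary5p2:
  fixes G :: "'v pair_pre_digraph"
    and S :: "(real ^ 'n \<Rightarrow> real ^ 'n) set"
    and \<Phi> :: "(real ^ 'n \<Rightarrow> real ^ 'n) \<Rightarrow> 'v \<Rightarrow> 'v"
    and p :: "'v \<Rightarrow> real ^ 'n"
  assumes "simple_graph G"
    and "symmetry_group S"
    and "\<Phi> \<in> S \<rightarrow>\<^sub>E Aut G"
    and "(G, p) \<in> realizations_of_type G S \<Phi>"
  shows "(\<forall>\<Psi> \<in> S \<rightarrow>\<^sub>E Aut G. \<Psi> \<noteq> \<Phi> \<longrightarrow> (G, p) \<notin> realizations_of_type G S \<Psi>)
         \<longleftrightarrow> Aut_framework G p = {id}"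
proof
  assume unique: "\<forall>\<Psi> \<in> S \<rightarrow>\<^sub>E Aut G. \<Psi> \<noteq> \<Phi> \<longrightarrow> (G, p) \<notin> realizations_of_type G S \<Psi>"
  have idS: "id \<in> S"
    using subgroup.one_closed[of S orthogonal_group] assms(2)
    by (simp add: symmetry_group_def orthogonal_group_def)
  have perm: "\<Phi> x permutes pverts G" if "x \<in> S" for x
    using that assms(3) Aut_permutes by blast
  have "\<alpha> = id" if \<alpha>: "\<alpha> \<in> Aut_framework G p" for \<alpha>
  proof -
    \<comment> \<open>Changing \<Phi> at a single element of \<open>S\<close> suffices, and
      \<open>id\<close> is one that every symmetry group has. \<open>\<Phi> id\<close> may differ
      from \<open>id\<close>, since \<Phi> is not assumed to be a homomorphism.\<close>
    define \<Psi> where "\<Psi> = \<Phi>(id := \<alpha> \<circ> \<Phi> id)"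
    have "\<alpha> \<in> Aut G" using \<alpha> by (simp add: Aut_framework_def)
    then have "\<alpha> \<circ> \<Phi> id \<in> Aut G" using assms(3) idS by (intro Aut_comp) auto
    then have \<Psi>: "\<Psi> \<in> S \<rightarrow>\<^sub>E Aut G"
      using assms(3) idS by (auto simp: \<Psi>_def PiE_iff extensional_def)
    \<comment> \<open>The composite is \<alpha> when \<open>x = id\<close> and the identity for
      every other \<open>x\<close>.\<close>
    have "\<Psi> x \<circ> inv_into UNIV (\<Phi> x) \<in> Aut_framework G p" if "x \<in> S" for x
      using \<alpha> id_in_Aut_framework[of G p]
      by (simp add: \<Psi>_def comp_assoc permutes_inv_o(1)[OF perm[OF that]]
          permutes_inv_o(1)[OF perm[OF idS]])
    then have "(G, p) \<in> realizations_of_type G S \<Psi>"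
      using realizations_of_type_iff_coset[of \<Phi> S G \<Psi> p] assms(3,4) \<Psi> by (auto simp: PiE_iff)
    then have "\<Psi> = \<Phi>" using unique \<Psi> by blast
    then have "\<alpha> \<circ> \<Phi> id = \<Phi> id" by (metis \<Psi>_def fun_upd_same)
    \<comment> \<open>Cancel the permutation \<open>\<Phi> id\<close> on the right.\<close>
    then show "\<alpha> = id"
      by (metis comp_assoc comp_id permutes_inv_o(1)[OF perm[OF idS]])
  qed
  then show "Aut_framework G p = {id}" using id_in_Aut_framework by blast
next
  assume trivial: "Aut_framework G p = {id}"
  \<comment> \<open>Both maps are \<open>undefined\<close> outside \<open>S\<close>, so agreement on
    \<open>S\<close> already makes them equal as functions.\<close>
  have "\<Psi> = \<Phi>"
    if \<Psi>: "\<Psi> \<in> S \<rightarrow>\<^sub>E Aut G" "(G, p) \<in> realizations_of_type G S \<Psi>" for \<Psi>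
  proof (rule PiE_ext[OF \<Psi>(1) assms(3)])
    fix x assume x: "x \<in> S"
    have "\<Psi> x \<circ> inv_into UNIV (\<Phi> x) = id"
      using realizations_of_type_iff_coset[of \<Phi> S G \<Psi> p] assms(3,4) \<Psi> trivial x
      by (auto simp: PiE_iff)
    moreover have "\<Phi> x permutes pverts G" using assms(3) x Aut_permutes by blast
    ultimately show "\<Psi> x = \<Phi> x" by (metis comp_assoc comp_id id_comp permutes_inv_o(2))
  qed
  then show "\<forall>\<Psi> \<in> S \<rightarrow>\<^sub>E Aut G. \<Psi> \<noteq> \<Phi> \<longrightarrow> (G, p) \<notin> realizations_of_type G S \<Psi>" by blast
qed

end
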